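(* Assume moreover that the lowering operator $L_\nu=\mathcal{D}$ is independent of $\nu$. Let $\nu\in\mathcal V$, $n\in\mathbb N$, and let $f,g$ be functions for which all integrals below converge, the Leibniz rule for $\partial^n$ applies to $w_{\nu+n\sigma}\cdot f$, and the adjointness relation $\langle R_\nu\cdots R_{\nu+(n-1)\sigma}f,g\rangle_{L^2(\mu^{(\nu)})}=\langle f,L_{\nu+(n-1)\sigma}\cdots L_\nu g\rangle_{L^2(\mu^{(\nu+n\sigma)})}$ applies (e.g. $f,g$ polynomials). Then $$\sum_{k=0}^n\alpha^n_k\int_{\mathbb{R}}\frac{\bigl(\eta^k(w_{\nu+k\sigma})\bigr)(x)}{w_\nu(x)}\bigl(\eta^k(p_{n-k}^{(\nu+k\sigma)})\bigr)(x)\,(T_{k,n}f)(x)\,g(x)\,d\mu^{(\nu)}(x)=\int_{\mathbb{R}}f(x)\,(\mathcal{D}^ng)(x)\,d\mu^{(\nu+n\sigma)}(x).$$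
   Context: Setting. $\mathcal{V}$ is a (multi-parameter) set of parameters in some $\mathbb{R}^d$, and $\sigma\in\mathbb{R}^d$ is a fixed element such that $\nu\in\mathcal{V}$ implies $\nu+k\sigma\in\mathcal{V}$ for all $k\in\mathbb{N}=\{0,1,2,\dots\}$. For each $\nu\in\mathcal{V}$, $\mu^{(\nu)}$ is a positive Borel measure on $\mathbb{R}$ with infinite support and all moments finite. Functions are real-valued in the inner products, $\langle f,g\rangle_{L^2(\mu)}=\int_{\mathbb R}f g\,d\mu$. For each $\nu\in\mathcal V$ there is a densely defined raising operator $R_\nu: L^2(\mu^{(\nu+\sigma)})\to L^2(\mu^{(\nu)})$ mapping polynomials of degree $n$ to polynomials of degree $n+1$; its adjoint $L_\nu=(R_\nu)^*: L^2(\mu^{(\nu)})\to L^2(\mu^{(\nu+\sigma)})$ is a densely defined lowering operator, mapping polynomials of degree $n$ to polynomials of degree $n-1$ (and constants to $0$), so $\langle R_\nu f,g\rangle_{L^2(\mu^{(\nu)})}=\langle f,L_\nu g\rangle_{L^2(\mu^{(\nu+\sigma)})}$ for $f,g$ in the respective domains. All polynomials are in the domains of $R_\nu$ and $L_\nu$. Set $$p_n^{(\nu)}=R_\nu R_{\nu+\sigma}\cdots R_{\nu+(n-1)\sigma}\mathbf{1},$$ where $\mathbf 1$ is the constant function $1$ (so $p_0^{(\nu)}=\mathbf 1$); these are orthogonal polynomials for $\mu^{(\nu)}$. It is assumed that $R_\nu=M_\nu^{-1}\circ\partial\circ M_{\nu+\sigma}$, where $(M_\nu f)(x)=w_\nu(x)f(x)$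 for a function $w_\nu$ with $w_\nu>0$ $\mu^{(\nu)}$-a.e., and $\partial$ is a linear operator on functions, independent of $\nu$, with the $w_\nu$ in the domain of $\partial$ (and of its powers as needed). It is assumed that there is a Leibniz rule: for all $n\in\mathbb N$ and all functions $f,g$ for which the expressions are well defined, $$\bigl(\partial^n(fg)\bigr)(x)=\sum_{k=0}^n\alpha^n_k\,(\eta^k\partial^{n-k}f)(x)\,(T_{k,n}g)(x),$$ where $\alpha^n_k$ are constants, $\eta$ is a fixed invertible homomorphism acting on functions (so $\eta(fg)=\eta(f)\eta(g)$), and $T_{k,n}$ are fixed operators on functions. *)

theory Defs
  imports "HOL-Analysis.Analysis" "HOL-Computational_Algebra.Polynomial"
begin

text \<open>
  Functions on the real line are taken complex valued, because the operators in the Leibniz rule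
  (for instance a shift of the argument in an imaginary direction) need not preserve real-valuedness.
  The functions in the spaces \<open>L\<^sup>2\<close> are real valued. An operator is a partial map
  on functions, so that composition \<open>\<circ>\<^sub>m\<close> carries its natural domain.
\<close>

type_synonym fn = "real \<Rightarrow> complex"
type_synonym oper = "fn \<rightharpoonup> fn"

definition mult_op :: "fn \<Rightarrow> fn \<Rightarrow> fn" where
  "mult_op w f = (\<lambda>x. w x * f x)"

definition poly_fn :: "real poly \<Rightarrow> fn" where
  "poly_fn p = (\<lambda>x. complex_of_real (poly p x))"

primrec op_pow :: "oper \<Rightarrow> nat \<Rightarrow> oper" where
  "op_pow A 0 = Some"
| "op_pow A (Suc n) = A \<circ>\<^sub>m op_pow A n"

text \<open>Real scalars, so that operators defined on real-valued functions only are covered as well.\<close>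

definition real_linear :: "oper \<Rightarrow> bool" where
  "real_linear A \<longleftrightarrow> A (\<lambda>_. 0) = Some (\<lambda>_. 0) \<and>
    (\<forall>f g f' g' a b. A f = Some f' \<longrightarrow> A g = Some g' \<longrightarrow>
      A (\<lambda>x. complex_of_real a * f x + complex_of_real b * g x)
        = Some (\<lambda>x. complex_of_real a * f' x + complex_of_real b * g' x))"


subsection \<open>Measures and operators between real L2 spaces\<close>

definition measure_support :: "real measure \<Rightarrow> real set" where
  "measure_support M = {x. \<forall>U. open U \<longrightarrow> x \<in> U \<longrightarrow> emeasure M U > 0}"

definition L2 :: "real measure \<Rightarrow> fn set" where
  "L2 M = {f \<in> borel_measurable M. (AE x in M. f x \<in> \<real>) \<and> integrable M (\<lambda>x. (cmod (f x))\<^sup>2)}"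

definition inner_L2 :: "real measure \<Rightarrow> fn \<Rightarrow> fn \<Rightarrow> complex" where
  "inner_L2 M f g = (LINT x|M. f x * g x)"

text \<open>
  The graph of the operator \<open>L\<^sup>2(M) \<rightarrow> L\<^sup>2(N)\<close> induced by \<open>A\<close>. The operator \<open>A\<close> acts on selected
  representatives; its graph is saturated with respect to almost everywhere equality.
\<close>

definition L2_graph :: "real measure \<Rightarrow> real measure \<Rightarrow> oper \<Rightarrow> (fn \<times> fn) set" where
  "L2_graph M N A = {(f, h). f \<in> L2 M \<and> h \<in> L2 N \<and>
     (\<exists>f' h'. A f' = Some h' \<and> (AE x in M. f' x = f x) \<and> (AE x in N. h' x = h x))}"

definition densely_defined_op :: "real measure \<Rightarrow> real measure \<Rightarrow> oper \<Rightarrow> bool" where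
  "densely_defined_op M N A \<longleftrightarrow>
     dom A \<subseteq> L2 M \<and> ran A \<subseteq> L2 N \<and>
     (\<forall>f h h'. (f, h) \<in> L2_graph M N A \<longrightarrow> (f, h') \<in> L2_graph M N A \<longrightarrow> (AE x in N. h x = h' x)) \<and>
     (\<forall>f h f' h' a b. (f, h) \<in> L2_graph M N A \<longrightarrow> (f', h') \<in> L2_graph M N A \<longrightarrow>
        ((\<lambda>x. complex_of_real a * f x + complex_of_real b * f' x),
         (\<lambda>x. complex_of_real a * h x + complex_of_real b * h' x)) \<in> L2_graph M N A) \<and>
     (\<forall>f \<in> L2 M. \<forall>e > 0. \<exists>g \<in> dom A. (LINT x|M. (cmod (f x - g x))\<^sup>2) < e)"

definition is_adjoint :: "real measure \<Rightarrow> real measure \<Rightarrow> oper \<Rightarrow> oper \<Rightarrow> bool" where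
  "is_adjoint M N A B \<longleftrightarrow>
     L2_graph N M B = {(g, k). g \<in> L2 N \<and> k \<in> L2 M \<and>
       (\<forall>(f, h) \<in> L2_graph M N A. inner_L2 N h g = inner_L2 M f k)}"


subsection \<open>Compositions along the orbit of the shift of the parameter\<close>

primrec raise_chain :: "real^'d \<Rightarrow> (real^'d \<Rightarrow> oper) \<Rightarrow> nat \<Rightarrow> real^'d \<Rightarrow> oper" where
  "raise_chain \<sigma> R 0 \<nu> = Some"
| "raise_chain \<sigma> R (Suc n) \<nu> = R \<nu> \<circ>\<^sub>m raise_chain \<sigma> R n (\<nu> + \<sigma>)"

primrec lower_chain :: "real^'d \<Rightarrow> (real^'d \<Rightarrow> oper) \<Rightarrow> nat \<Rightarrow> real^'d \<Rightarrow> oper" where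
  "lower_chain \<sigma> L 0 \<nu> = Some"
| "lower_chain \<sigma> L (Suc n) \<nu> = L (\<nu> + real n *\<^sub>R \<sigma>) \<circ>\<^sub>m lower_chain \<sigma> L n \<nu>"

definition ladder_poly :: "real^'d \<Rightarrow> (real^'d \<Rightarrow> oper) \<Rightarrow> nat \<Rightarrow> real^'d \<Rightarrow> fn" where
  "ladder_poly \<sigma> R n \<nu> = the (raise_chain \<sigma> R n \<nu> (\<lambda>_. 1))"


subsection \<open>The Leibniz rule and the setting\<close>

definition leibniz_defined :: "oper \<Rightarrow> oper \<Rightarrow> (nat \<Rightarrow> nat \<Rightarrow> oper) \<Rightarrow> nat \<Rightarrow> fn \<Rightarrow> fn \<Rightarrow> bool" where
  "leibniz_defined del \<eta> T n f g \<longleftrightarrow>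
     mult_op f g \<in> dom (op_pow del n) \<and>
     (\<forall>k\<le>n. f \<in> dom (op_pow \<eta> k \<circ>\<^sub>m op_pow del (n - k)) \<and> g \<in> dom (T k n))"

text \<open>
  In \<open>R_eq\<close> the identity \<open>R \<nu> = (M \<nu>)\<^sup>-\<^sup>1 \<circ> del \<circ> M (\<nu> + \<sigma>)\<close> on the domain of \<open>R \<nu>\<close>
  is written without an inverse, since \<open>w \<nu>\<close> may vanish on a null set.
  Invertibility of the partial map \<open>\<eta>\<close> means that it is injective on its domain.
\<close>

locale raising_lowering_family =
  fixes V :: "(real^'d) set" and \<sigma> :: "real^'d"
    and \<mu> :: "real^'d \<Rightarrow> real measure"
    and R L :: "real^'d \<Rightarrow> oper"
    and w :: "real^'d \<Rightarrow> fn"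
    and del :: oper
    and \<alpha> :: "nat \<Rightarrow> nat \<Rightarrow> complex"
    and \<eta> :: oper
    and T :: "nat \<Rightarrow> nat \<Rightarrow> oper"
  assumes shift_closed: "\<And>\<nu> k. \<nu> \<in> V \<Longrightarrow> \<nu> + real k *\<^sub>R \<sigma> \<in> V"
    and sets_mu: "\<And>\<nu>. \<nu> \<in> V \<Longrightarrow> sets (\<mu> \<nu>) = sets borel"
    and infinite_support: "\<And>\<nu>. \<nu> \<in> V \<Longrightarrow> infinite (measure_support (\<mu> \<nu>))"
    and moments: "\<And>\<nu> m. \<nu> \<in> V \<Longrightarrow> integrable (\<mu> \<nu>) (\<lambda>x. x ^ m)"
    and R_op: "\<And>\<nu>. \<nu> \<in> V \<Longrightarrow> densely_defined_op (\<mu> (\<nu> + \<sigma>)) (\<mu> \<nu>) (R \<nu>)"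
    and L_op: "\<And>\<nu>. \<nu> \<in> V \<Longrightarrow> densely_defined_op (\<mu> \<nu>) (\<mu> (\<nu> + \<sigma>)) (L \<nu>)"
    and L_adjoint: "\<And>\<nu>. \<nu> \<in> V \<Longrightarrow> is_adjoint (\<mu> (\<nu> + \<sigma>)) (\<mu> \<nu>) (R \<nu>) (L \<nu>)"
    and poly_dom: "\<And>\<nu> q. \<nu> \<in> V \<Longrightarrow> poly_fn q \<in> dom (R \<nu>) \<and> poly_fn q \<in> dom (L \<nu>)"
    and R_poly: "\<And>\<nu> q. \<nu> \<in> V \<Longrightarrow> q \<noteq> 0 \<Longrightarrow>
        \<exists>r. degree r = degree q + 1 \<and> R \<nu> (poly_fn q) = Some (poly_fn r)"
    and L_poly: "\<And>\<nu> q. \<nu> \<in> V \<Longrightarrow> degree q \<ge> 1 \<Longrightarrow>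
        \<exists>r. r \<noteq> 0 \<and> degree r = degree q - 1 \<and> L \<nu> (poly_fn q) = Some (poly_fn r)"
    and L_const: "\<And>\<nu> c. \<nu> \<in> V \<Longrightarrow> L \<nu> (poly_fn [:c:]) = Some (\<lambda>_. 0)"
    and w_pos: "\<And>\<nu>. \<nu> \<in> V \<Longrightarrow> AE x in \<mu> \<nu>. w \<nu> x \<in> \<real> \<and> Re (w \<nu> x) > 0"
    and R_eq: "\<And>\<nu> f h. \<nu> \<in> V \<Longrightarrow> R \<nu> f = Some h \<Longrightarrow>
        del (mult_op (w (\<nu> + \<sigma>)) f) = Some (mult_op (w \<nu>) h)"
    and del_linear: "real_linear del"
    and w_dom: "\<And>\<nu>. \<nu> \<in> V \<Longrightarrow> w \<nu> \<in> dom del"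
    and w_dom_pow: "\<And>\<nu> m. \<nu> \<in> V \<Longrightarrow> w (\<nu> + real m *\<^sub>R \<sigma>) \<in> dom (op_pow del m)"
    and eta_inj: "inj_on \<eta> (dom \<eta>)"
    and eta_mult: "\<And>f g f' g'. \<eta> f = Some f' \<Longrightarrow> \<eta> g = Some g' \<Longrightarrow>
        \<eta> (mult_op f g) = Some (mult_op f' g')"
    and leibniz: "\<And>m f g. leibniz_defined del \<eta> T m f g \<Longrightarrow>
        op_pow del m (mult_op f g) = Some (\<lambda>x. \<Sum>k\<le>m.
          \<alpha> m k * the ((op_pow \<eta> k \<circ>\<^sub>m op_pow del (m - k)) f) x * the (T k m g) x)"

end

theory Submission
  imports Defs
begin

text \<open>
  The weights telescope along a chain of raising operators: since
  \<open>w \<nu> \<cdot> R \<nu> f = del (w (\<nu> + \<sigma>) \<cdot> f)\<close>, the product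
  \<open>R \<nu> \<cdots> R (\<nu> + (n - 1) \<sigma>) f\<close>, multiplied by \<open>w \<nu>\<close>, is the single expression
  \<open>del\<^sup>n (w (\<nu> + n \<sigma>) \<cdot> f)\<close> (lemma \<open>weight_raise_chain\<close>). This Rodrigues type formula enters twice.
  For the given \<open>f\<close> the Leibniz rule expands it into a sum over \<open>k\<close>, whose terms contain
  \<open>\<eta>\<^sup>k (del\<^sup>n\<^sup>-\<^sup>k (w (\<nu> + n \<sigma>)))\<close>. For \<open>f = 1\<close>, with start \<open>\<nu> + k \<sigma>\<close> and length \<open>n - k\<close>, it
  identifies \<open>del\<^sup>n\<^sup>-\<^sup>k (w (\<nu> + n \<sigma>))\<close> as \<open>w (\<nu> + k \<sigma>)\<close> times the orthogonal polynomial of degree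
  \<open>n - k\<close> for \<open>\<nu> + k \<sigma>\<close>, and the homomorphism \<open>\<eta>\<^sup>k\<close> splits this product
  (lemma \<open>eta_pow_del_pow_weight\<close>).

  Division by \<open>w \<nu>\<close>, which vanishes at most on a null set, multiplication by \<open>g\<close> and
  integration turn the sum into
  \<open>\<langle>R \<nu> \<cdots> R (\<nu> + (n - 1) \<sigma>) f, g\<rangle>\<close>. Adjointness moves the raising operators to
  \<open>g\<close>, where they become \<open>n\<close> lowering operators, each a restriction of \<open>\<D>\<close>.
\<close>

lemma lower_chain_map_le_op_pow:
  assumes "\<And>m. m < n \<Longrightarrow> L (\<nu> + real m *\<^sub>R \<sigma>) \<subseteq>\<^sub>m D"
  shows "lower_chain \<sigma> L n \<nu> \<subseteq>\<^sub>m op_pow D n"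
  using assms
proof (induction n)
  case (Suc n)
  have IH: "lower_chain \<sigma> L n \<nu> \<subseteq>\<^sub>m op_pow D n"
    using Suc by simp
  show ?case
    unfolding map_le_def
  proof
    fix g assume "g \<in> dom (lower_chain \<sigma> L (Suc n) \<nu>)"
    then obtain h k where h: "lower_chain \<sigma> L n \<nu> g = Some h"
      and k: "L (\<nu> + real n *\<^sub>R \<sigma>) h = Some k"
      by (auto simp: map_comp_Some_iff)
    have "op_pow D n g = Some h"
      using IH h by (metis domI map_le_def)
    moreover have "D h = Some k"
      using Suc.prems[of n] k by (metis domI lessI map_le_def)
    ultimately show "lower_chain \<sigma> L (Suc n) \<nu> g = op_pow D (Suc n) g"
      using h k by simp
  qed
qed simp

lemma dom_lower_chain_subset:
  assumes "n > 0"
  shows "dom (lower_chain \<sigma> L n \<nu>) \<subseteq> dom (L \<nu>)"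
  using assms
proof (induction n)
  case (Suc n)
  show ?case
  proof (cases "n = 0")
    case False
    have "dom (lower_chain \<sigma> L (Suc n) \<nu>) \<subseteq> dom (lower_chain \<sigma> L n \<nu>)"
      by (auto simp: map_comp_Some_iff)
    with False Suc.IH show ?thesis by blast
  qed (auto simp: map_comp_Some_iff)
qed simp

lemma op_pow_mult:
  assumes hom: "\<And>f g f' g'. A f = Some f' \<Longrightarrow> A g = Some g' \<Longrightarrow>
      A (mult_op f g) = Some (mult_op f' g')"
    and "op_pow A k f = Some f'" "op_pow A k g = Some g'"
  shows "op_pow A k (mult_op f g) = Some (mult_op f' g')"
  using assms(2,3)
  by (induction k arbitrary: f' g') (auto simp: map_comp_Some_iff hom)

context raising_lowering_family
begin

lemma weight_raise_chain:
  assumes "\<nu> \<in> V" "raise_chain \<sigma> R n \<nu> f = Some h"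
  shows "op_pow del n (mult_op (w (\<nu> + real n *\<^sub>R \<sigma>)) f) = Some (mult_op (w \<nu>) h)"
  using assms
proof (induction n arbitrary: \<nu> h)
  case (Suc n)
  have V: "\<nu> + \<sigma> \<in> V"
    using shift_closed[OF Suc.prems(1), of 1] by simp
  obtain h' where h': "raise_chain \<sigma> R n (\<nu> + \<sigma>) f = Some h'" "R \<nu> h' = Some h"
    using Suc.prems(2) by (auto simp: map_comp_Some_iff)
  have "\<nu> + real (Suc n) *\<^sub>R \<sigma> = \<nu> + \<sigma> + real n *\<^sub>R \<sigma>"
    by (simp add: algebra_simps)
  then have "op_pow del n (mult_op (w (\<nu> + real (Suc n) *\<^sub>R \<sigma>)) f)
      = Some (mult_op (w (\<nu> + \<sigma>)) h')"
    using Suc.IH[OF V h'(1)] by (simp only:)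
  then show ?case
    using R_eq[OF Suc.prems(1) h'(2)] by simp
qed simp

lemma raise_chain_one_poly:
  assumes "\<nu> \<in> V"
  shows "\<exists>q. q \<noteq> 0 \<and> raise_chain \<sigma> R n \<nu> (\<lambda>_. 1) = Some (poly_fn q)"
  using assms
proof (induction n arbitrary: \<nu>)
  case 0
  have "poly_fn 1 = (\<lambda>_. 1)"
    by (simp add: poly_fn_def)
  then show ?case
    by (metis one_neq_zero raise_chain.simps(1))
next
  case (Suc n)
  have "\<nu> + \<sigma> \<in> V"
    using shift_closed[OF Suc.prems, of 1] by simp
  from Suc.IH[OF this] obtain q
    where q: "q \<noteq> 0" "raise_chain \<sigma> R n (\<nu> + \<sigma>) (\<lambda>_. 1) = Some (poly_fn q)"
    by blast
  from R_poly[OF Suc.prems q(1)] obtain r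
    where r: "degree r = degree q + 1" "R \<nu> (poly_fn q) = Some (poly_fn r)"
    by blast
  from r(1) have "r \<noteq> 0" by auto
  with q r show ?case by auto
qed

lemma raise_chain_one:
  assumes "\<nu> \<in> V"
  shows "raise_chain \<sigma> R n \<nu> (\<lambda>_. 1) = Some (ladder_poly \<sigma> R n \<nu>)"
  using raise_chain_one_poly[OF assms, of n] by (auto simp: ladder_poly_def)

text \<open>
  The factor of the \<open>k\<close>-th Leibniz term that comes from the weight: the chain from
  \<open>\<nu> + k \<sigma>\<close> of length \<open>n - k\<close> ends at \<open>\<nu> + n \<sigma>\<close>, so the formula \<open>weight_raise_chain\<close> for
  the constant \<open>1\<close> evaluates the inner power of \<open>del\<close>.
\<close>

lemma eta_pow_del_pow_weight:
  assumes "\<nu> \<in> V" "k \<le> n"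
    and "op_pow \<eta> k (w (\<nu> + real k *\<^sub>R \<sigma>)) = Some u"
    and "op_pow \<eta> k (ladder_poly \<sigma> R (n - k) (\<nu> + real k *\<^sub>R \<sigma>)) = Some p"
  shows "(op_pow \<eta> k \<circ>\<^sub>m op_pow del (n - k)) (w (\<nu> + real n *\<^sub>R \<sigma>)) = Some (mult_op u p)"
proof -
  let ?\<nu> = "\<nu> + real k *\<^sub>R \<sigma>"
  have V: "?\<nu> \<in> V"
    by (rule shift_closed[OF assms(1)])
  have end_eq: "?\<nu> + real (n - k) *\<^sub>R \<sigma> = \<nu> + real n *\<^sub>R \<sigma>"
    using assms(2) by (simp add: of_nat_diff algebra_simps)
  have "op_pow del (n - k) (w (\<nu> + real n *\<^sub>R \<sigma>))
      = Some (mult_op (w ?\<nu>) (ladder_poly \<sigma> R (n - k) ?\<nu>))"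
    using weight_raise_chain[OF V raise_chain_one[OF V, of "n - k"], unfolded end_eq]
    by (simp add: mult_op_def)
  moreover have "op_pow \<eta> k (mult_op (w ?\<nu>) (ladder_poly \<sigma> R (n - k) ?\<nu>)) = Some (mult_op u p)"
    by (rule op_pow_mult[OF eta_mult assms(3,4)])
  ultimately show ?thesis by simp
qed

text \<open>
  The Leibniz rule for \<open>w (\<nu> + n \<sigma>) \<cdot> f\<close>, divided by the weight \<open>w \<nu>\<close>. The zeros of
  \<open>w \<nu>\<close> form a null set, so the identity survives integration against \<open>\<mu> \<nu>\<close>.
\<close>

lemma raise_chain_expansion:
  assumes "\<nu> \<in> V"
    and leib: "leibniz_defined del \<eta> T n (w (\<nu> + real n *\<^sub>R \<sigma>)) f"
    and h: "raise_chain \<sigma> R n \<nu> f = Some h"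
    and w_dom: "\<And>k. k \<le> n \<Longrightarrow> w (\<nu> + real k *\<^sub>R \<sigma>) \<in> dom (op_pow \<eta> k)"
    and p_dom: "\<And>k. k \<le> n \<Longrightarrow>
      ladder_poly \<sigma> R (n - k) (\<nu> + real k *\<^sub>R \<sigma>) \<in> dom (op_pow \<eta> k)"
    and nz: "w \<nu> x \<noteq> 0"
  shows "h x = (\<Sum>k\<le>n. \<alpha> n k * (the (op_pow \<eta> k (w (\<nu> + real k *\<^sub>R \<sigma>))) x / w \<nu> x
           * the (op_pow \<eta> k (ladder_poly \<sigma> R (n - k) (\<nu> + real k *\<^sub>R \<sigma>))) x
           * the (T k n f) x))"
proof -
  let ?u = "\<lambda>k. the (op_pow \<eta> k (w (\<nu> + real k *\<^sub>R \<sigma>)))"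
  let ?p = "\<lambda>k. the (op_pow \<eta> k (ladder_poly \<sigma> R (n - k) (\<nu> + real k *\<^sub>R \<sigma>)))"
  let ?c = "\<lambda>k. the ((op_pow \<eta> k \<circ>\<^sub>m op_pow del (n - k)) (w (\<nu> + real n *\<^sub>R \<sigma>)))"
  have c: "?c k = mult_op (?u k) (?p k)" if "k \<le> n" for k
    using eta_pow_del_pow_weight[OF assms(1) that, of "?u k" "?p k"]
      w_dom[OF that] p_dom[OF that] by (auto simp: domIff)
  have "mult_op (w \<nu>) h = (\<lambda>x. \<Sum>k\<le>n. \<alpha> n k * ?c k x * the (T k n f) x)"
    using weight_raise_chain[OF assms(1) h] leibniz[OF leib] by simp
  then have "w \<nu> x * h x = (\<Sum>k\<le>n. \<alpha> n k * ?c k x * the (T k n f) x)"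
    by (simp add: mult_op_def fun_eq_iff)
  also have "\<dots> = (\<Sum>k\<le>n. \<alpha> n k * (?u k x * ?p k x) * the (T k n f) x)"
    by (rule sum.cong) (simp_all add: c mult_op_def)
  also have "\<dots> = w \<nu> x * (\<Sum>k\<le>n. \<alpha> n k * (?u k x / w \<nu> x * ?p k x * the (T k n f) x))"
    unfolding sum_distrib_left using nz by (intro sum.cong) auto
  finally show ?thesis using nz by simp
qed

lemma raise_chain_measurable:
  assumes "\<nu> \<in> V" "n > 0" "raise_chain \<sigma> R n \<nu> f = Some h"
  shows "h \<in> borel_measurable (\<mu> \<nu>)"
proof -
  obtain m where "n = Suc m" using assms(2) gr0_implies_Suc by blast
  with assms(3) have "h \<in> ran (R \<nu>)"
    by (auto simp: map_comp_Some_iff intro: ranI)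
  then show ?thesis
    using R_op[OF assms(1)] by (auto simp: densely_defined_op_def L2_def)
qed

lemma dom_lower_chain_measurable:
  assumes "\<nu> \<in> V" "n > 0" "g \<in> dom (lower_chain \<sigma> L n \<nu>)"
  shows "g \<in> borel_measurable (\<mu> \<nu>)"
proof -
  have "g \<in> dom (L \<nu>)"
    using dom_lower_chain_subset[OF assms(2)] assms(3) by blast
  moreover have "dom (L \<nu>) \<subseteq> L2 (\<mu> \<nu>)"
    using L_op[OF assms(1)] unfolding densely_defined_op_def by blast
  ultimately show ?thesis
    unfolding L2_def by blast
qed

end

theorem corollary2p3:
  fixes V :: "(real^'d) set" and \<sigma> \<nu> :: "real^'d"
    and \<mu> :: "real^'d \<Rightarrow> real measure"
    and R L :: "real^'d \<Rightarrow> oper" and w :: "real^'d \<Rightarrow> fn"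
    and del \<eta> \<D> :: oper and \<alpha> :: "nat \<Rightarrow> nat \<Rightarrow> complex"
    and T :: "nat \<Rightarrow> nat \<Rightarrow> oper"
    and n :: nat and f g :: fn
  assumes "raising_lowering_family V \<sigma> \<mu> R L w del \<alpha> \<eta> T"
    and "\<And>\<nu>'. \<nu>' \<in> V \<Longrightarrow> L \<nu>' \<subseteq>\<^sub>m \<D>"
    and "\<nu> \<in> V"
    and "leibniz_defined del \<eta> T n (w (\<nu> + real n *\<^sub>R \<sigma>)) f"
    and "f \<in> dom (raise_chain \<sigma> R n \<nu>)"
    and "g \<in> dom (lower_chain \<sigma> L n \<nu>)"
    and "inner_L2 (\<mu> \<nu>) (the (raise_chain \<sigma> R n \<nu> f)) g
         = inner_L2 (\<mu> (\<nu> + real n *\<^sub>R \<sigma>)) f (the (lower_chain \<sigma> L n \<nu> g))"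
    and "\<And>k. k \<le> n \<Longrightarrow> w (\<nu> + real k *\<^sub>R \<sigma>) \<in> dom (op_pow \<eta> k)"
    and "\<And>k. k \<le> n \<Longrightarrow> ladder_poly \<sigma> R (n - k) (\<nu> + real k *\<^sub>R \<sigma>) \<in> dom (op_pow \<eta> k)"
    and "\<And>k. k \<le> n \<Longrightarrow> integrable (\<mu> \<nu>) (\<lambda>x.
           the (op_pow \<eta> k (w (\<nu> + real k *\<^sub>R \<sigma>))) x / w \<nu> x
           * the (op_pow \<eta> k (ladder_poly \<sigma> R (n - k) (\<nu> + real k *\<^sub>R \<sigma>))) x
           * the (T k n f) x * g x)"
    and "integrable (\<mu> (\<nu> + real n *\<^sub>R \<sigma>)) (\<lambda>x. f x * the (op_pow \<D> n g) x)"
  shows "(\<Sum>k\<le>n. \<alpha> n k * (LINT x|\<mu> \<nu>.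
           the (op_pow \<eta> k (w (\<nu> + real k *\<^sub>R \<sigma>))) x / w \<nu> x
           * the (op_pow \<eta> k (ladder_poly \<sigma> R (n - k) (\<nu> + real k *\<^sub>R \<sigma>))) x
           * the (T k n f) x * g x))
         = (LINT x|\<mu> (\<nu> + real n *\<^sub>R \<sigma>). f x * the (op_pow \<D> n g) x)"
proof -
  interpret raising_lowering_family V \<sigma> \<mu> R L w del \<alpha> \<eta> T
    by (rule assms(1))
  define F where "F k x = the (op_pow \<eta> k (w (\<nu> + real k *\<^sub>R \<sigma>))) x / w \<nu> x
      * the (op_pow \<eta> k (ladder_poly \<sigma> R (n - k) (\<nu> + real k *\<^sub>R \<sigma>))) x
      * the (T k n f) x * g x" for k x
  obtain h where h: "raise_chain \<sigma> R n \<nu> f = Some h"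
    using assms(5) by blast
  obtain d where d: "lower_chain \<sigma> L n \<nu> g = Some d"
    using assms(6) by blast
  have "lower_chain \<sigma> L n \<nu> \<subseteq>\<^sub>m op_pow \<D> n"
    by (intro lower_chain_map_le_op_pow assms(2) shift_closed assms(3))
  then have D: "op_pow \<D> n g = Some d"
    using d by (metis domI map_le_def)
  have F_int: "integrable (\<mu> \<nu>) (F k)" if "k \<le> n" for k
    using assms(10)[OF that] unfolding F_def .
  then have sum_int: "integrable (\<mu> \<nu>) (\<lambda>x. \<Sum>k\<le>n. \<alpha> n k * F k x)"
    by auto
  have ae: "AE x in \<mu> \<nu>. h x * g x = (\<Sum>k\<le>n. \<alpha> n k * F k x)"
    using w_pos[OF assms(3)]
  proof eventually_elim
    case (elim x)
    then have "w \<nu> x \<noteq> 0" by auto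
    from raise_chain_expansion[OF assms(3,4) h assms(8,9) this] show ?case
      by (simp add: F_def sum_distrib_right mult.assoc)
  qed
  \<comment> \<open>The ranges and domains of the operators consist of measurable functions, but for
      \<open>n = 0\<close> no operator acts; then \<open>f \<cdot> g\<close> is the integrand on the right-hand side.\<close>
  have meas: "(\<lambda>x. h x * g x) \<in> borel_measurable (\<mu> \<nu>)"
  proof (cases "n = 0")
    case True
    then show ?thesis
      using borel_measurable_integrable[OF assms(11)] h by simp
  next
    case False
    then show ?thesis
      using raise_chain_measurable[OF assms(3) _ h]
        dom_lower_chain_measurable[OF assms(3) _ assms(6)] by simp
  qed
  have "(\<Sum>k\<le>n. \<alpha> n k * (LINT x|\<mu> \<nu>. F k x)) = (LINT x|\<mu> \<nu>. (\<Sum>k\<le>n. \<alpha> n k * F k x))"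
    using F_int by (simp add: Bochner_Integration.integral_sum)
  also have "\<dots> = (LINT x|\<mu> \<nu>. h x * g x)"
    using ae by (intro integral_cong_AE borel_measurable_integrable[OF sum_int] meas)
      (auto elim: eventually_mono)
  also have "\<dots> = (LINT x|\<mu> (\<nu> + real n *\<^sub>R \<sigma>). f x * the (op_pow \<D> n g) x)"
    using assms(7) h d D by (simp add: inner_L2_def)
  finally show ?thesis
    unfolding F_def .
qed

end
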